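(* There exists a deterministic algorithm which, given query access to any monotone function $f:\{0,1\}^n\to\{0,1\}$ and an input $x^{\star}\in\{0,1\}^n$, makes $O(C(f)\cdot\log n)$ queries to $f$ and outputs a set $S\subseteq[n]$ of size $C(f)$ that is a certificate for the value $f(x^{\star})$.
   Context: A function $f:\{0,1\}^n\to\mathbb{D}$ (with $\mathbb{D}\subseteq\mathbb{R}$) is monotone if $x\le y$ coordinatewise implies $f(x)\le f(y)$. For $x\in\{0,1\}^n$ and $S\subseteq[n]$, $x|_S$ denotes the restriction of $x$ to the coordinates in $S$. A set $S\subseteq[n]$ is a certificate for $f$ at $x^{\star}$ (certifying the value $f(x^{\star})$) if every $y\in\{0,1\}^n$ with $y|_S=x^{\star}|_S$ satisfies $f(y)=f(x^{\star})$. $C(f,x)$ is the minimum size of a certificate for $f$ at $x$, and the certificate complexity of $f$ is $C(f)=\max_{x\in\{0,1\}^n}C(f,x)$. A query to $f$ consists of choosing a point $y\in\{0,1\}^n$ and receiving $f(y)$; the algorithm is not given $C(f)$.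
   Formalization: "A set of size C(f)" is proved as size at most C(f), since exact size is impossible within this query bound when C(f) is not given; "O(C(f) log n)" is read as O(max(1, C(f) log n)), since for constant f or n = 1 the product is 0 but a query is still needed. *)

theory Defs
  imports Complex_Main "HOL-Library.FuncSet"
begin

text \<open>Points of the cube are extensional functions (\<^const>\<open>undefined\<close> off \<open>{1..n}\<close>), so the
  pointwise order \<open>\<le>\<close> on functions agrees on them with the coordinatewise order, and
  \<^const>\<open>mono_on\<close> over the cube is monotonicity. \<^const>\<open>False\<close> and \<^const>\<open>True\<close> stand for 0 and 1.\<close>

definition cube :: "nat \<Rightarrow> (nat \<Rightarrow> bool) set" where
  "cube n = {1..n} \<rightarrow>\<^sub>E UNIV"

definition certificate :: "nat \<Rightarrow> ((nat \<Rightarrow> bool) \<Rightarrow> 'b) \<Rightarrow> (nat \<Rightarrow> bool) \<Rightarrow> nat set \<Rightarrow> bool" where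
  "certificate n f x S \<longleftrightarrow>
     S \<subseteq> {1..n} \<and> (\<forall>y\<in>cube n. restrict y S = restrict x S \<longrightarrow> f y = f x)"

definition cert_complexity_at :: "nat \<Rightarrow> ((nat \<Rightarrow> bool) \<Rightarrow> 'b) \<Rightarrow> (nat \<Rightarrow> bool) \<Rightarrow> nat" where
  "cert_complexity_at n f x = Min (card ` {S. certificate n f x S})"

definition cert_complexity :: "nat \<Rightarrow> ((nat \<Rightarrow> bool) \<Rightarrow> 'b) \<Rightarrow> nat" where
  "cert_complexity n f = Max (cert_complexity_at n f ` cube n)"

text \<open>A deterministic adaptive query algorithm, as a decision tree: \<open>Query q k\<close> asks for the value
  of the oracle at \<open>q\<close> and continues with \<open>k a\<close> on receiving the answer \<open>a\<close>. As a datatype value it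
  is well-founded, so every run terminates.\<close>

datatype ('q, 'a, 'r) query_alg =
    Output 'r
  | Query 'q "'a \<Rightarrow> ('q, 'a, 'r) query_alg"

primrec run_result :: "('q \<Rightarrow> 'a) \<Rightarrow> ('q, 'a, 'r) query_alg \<Rightarrow> 'r" where
  "run_result f (Output r) = r"
| "run_result f (Query q k) = run_result f (k (f q))"

primrec run_queries :: "('q \<Rightarrow> 'a) \<Rightarrow> ('q, 'a, 'r) query_alg \<Rightarrow> 'q list" where
  "run_queries f (Output r) = []"
| "run_queries f (Query q k) = q # run_queries f (k (f q))"

text \<open>A bound \<open>O(C(f) log n)\<close> on query counts is read as \<open>c * query_bound n f\<close>. The maximum with 1
  changes nothing when \<open>n \<ge> 2\<close> and \<open>f\<close> is not constant on the cube. Otherwise \<open>C(f) log n = 0\<close>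
  (with \<open>log 2 0 = 0\<close>) and \<open>O(1)\<close> queries are allowed: no algorithm can, for instance, distinguish
  a constant \<open>f\<close> from a nonconstant one without any query.\<close>

definition query_bound :: "nat \<Rightarrow> ((nat \<Rightarrow> bool) \<Rightarrow> 'b) \<Rightarrow> real" where
  "query_bound n f = max 1 (real (cert_complexity n f) * log 2 (real n))"

end

(* Order the coordinates where x has the value b = f x, and look for the shortest prefix such that
   switching all the other coordinates to not b keeps the value b.  The last coordinate of this
   prefix is indispensable for every certificate inside the prefix, so keep it for good and repeat
   on the shorter prefix.  Each kept coordinate costs one binary search.  The kept set T ends up
   inclusion-minimal, hence every coordinate of T is sensitive at the point that agrees with x on T
   and is not b elsewhere; any certificate at that point contains T, so card T is at most C(f). *)

theory Submission
  imports Defs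
begin

section \<open>Binary search along a sequence of queries\<close>

text \<open>Continuation style: a decision tree has no sequential composition, so the rest of the
  algorithm is passed as \<open>k\<close> and receives the index found. The answers at
  \<open>lo\<close> and \<open>hi\<close> are taken as known and cost no query.\<close>

function bisect ::
  "(nat \<Rightarrow> 'q) \<Rightarrow> 'a \<Rightarrow> nat \<Rightarrow> nat \<Rightarrow> (nat \<Rightarrow> ('q, 'a, 'r) query_alg) \<Rightarrow> ('q, 'a, 'r) query_alg"
where
  "bisect q b lo hi k =
     (if hi \<le> Suc lo then k hi
      else Query (q ((lo + hi) div 2))
             (\<lambda>a. if a = b then bisect q b lo ((lo + hi) div 2) k
                  else bisect q b ((lo + hi) div 2) hi k))"
  by pat_completeness auto
termination
  by (relation "measure (\<lambda>(q, b, lo, hi, k). hi - lo)") auto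

declare bisect.simps [simp del]

text \<open>A discrete intermediate value argument: either answer at the midpoint leaves an interval
  whose right end answers \<open>b\<close> and whose left end does not. Splitting off
  \<open>qs\<close> from the queries of \<open>k j\<close> lets costs add up over successive
  searches.\<close>

lemma bisect_correct:
  assumes "lo < hi" and "f (q hi) = b" and "f (q lo) \<noteq> b" and "hi - lo \<le> 2 ^ d"
  obtains j qs where "lo < j" "j \<le> hi" "f (q j) = b" "f (q (j - 1)) \<noteq> b"
    "length qs \<le> d" "set qs \<subseteq> range q"
    "run_result f (bisect q b lo hi k) = run_result f (k j)"
    "run_queries f (bisect q b lo hi k) = qs @ run_queries f (k j)"
proof -
  have "\<exists>j qs. lo < j \<and> j \<le> hi \<and> f (q j) = b \<and> f (q (j - 1)) \<noteq> b \<and>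
      length qs \<le> d \<and> set qs \<subseteq> range q \<and>
      run_result f (bisect q b lo hi k) = run_result f (k j) \<and>
      run_queries f (bisect q b lo hi k) = qs @ run_queries f (k j)"
    using assms
  proof (induction d arbitrary: lo hi)
    case 0
    then have "hi = Suc lo" by simp
    with 0 show ?case
      by (intro exI[of _ hi] exI[of _ "[]"]) (simp add: bisect.simps)
  next
    case (Suc d)
    show ?case
    proof (cases "hi \<le> Suc lo")
      case True
      with Suc.prems have "hi = Suc lo" by simp
      with Suc.prems show ?thesis
        by (intro exI[of _ hi] exI[of _ "[]"]) (simp add: bisect.simps)
    next
      case False
      define m where "m = (lo + hi) div 2"
      \<comment> \<open>The upper half may be longer by one, but 2^(d+1) is even, so rounding up
        stays within 2^d.\<close>
      have m: "lo < m" "m < hi" "m - lo \<le> 2 ^ d" "hi - m \<le> 2 ^ d"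
        using False Suc.prems(4) by (auto simp: m_def)
      have step: "bisect q b lo hi k = Query (q m)
          (\<lambda>a. if a = b then bisect q b lo m k else bisect q b m hi k)"
        unfolding m_def using False by (subst bisect.simps) simp
      show ?thesis
      proof (cases "f (q m) = b")
        case True
        obtain j qs where j: "lo < j" "j \<le> m" "f (q j) = b" "f (q (j - 1)) \<noteq> b"
          "length qs \<le> d" "set qs \<subseteq> range q"
          "run_result f (bisect q b lo m k) = run_result f (k j)"
          "run_queries f (bisect q b lo m k) = qs @ run_queries f (k j)"
          using Suc.IH[OF m(1) True Suc.prems(3) m(3)] by blast
        show ?thesis
          using j m True by (intro exI[of _ j] exI[of _ "q m # qs"]) (simp add: step)
      next
        case ne: False
        obtain j qs where j: "m < j" "j \<le> hi" "f (q j) = b" "f (q (j - 1)) \<noteq> b"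
          "length qs \<le> d" "set qs \<subseteq> range q"
          "run_result f (bisect q b m hi k) = run_result f (k j)"
          "run_queries f (bisect q b m hi k) = qs @ run_queries f (k j)"
          using Suc.IH[OF m(2) Suc.prems(2) ne m(4)] by blast
        show ?thesis
          using j m ne by (intro exI[of _ j] exI[of _ "q m # qs"]) (simp add: step)
      qed
    qed
  qed
  then show thesis using that by blast
qed

section \<open>Greedy minimization in an upward closed family\<close>

text \<open>The first natural number argument is fuel that only makes the recursion primitive: \<open>hi\<close>
  decreases in every round, so \<open>hi\<close> rounds suffice.\<close>

primrec minimize ::
  "(nat set \<Rightarrow> 'q) \<Rightarrow> 'a \<Rightarrow> nat \<Rightarrow> nat set \<Rightarrow> nat \<Rightarrow> ('q, 'a, nat set) query_alg"
where
  "minimize q b 0 K hi = Output K"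
| "minimize q b (Suc r) K hi = Query (q K) (\<lambda>a. if a = b then Output K
     else bisect (\<lambda>j. q (K \<union> {1..j})) b 0 hi (\<lambda>j. minimize q b r (insert j K) (j - 1)))"

lemma minimize_correct:
  fixes q :: "nat set \<Rightarrow> 'q" and f :: "'q \<Rightarrow> 'a" and b :: 'a
  defines "g \<equiv> \<lambda>S. f (q S) = b"
  assumes g_mono: "\<And>S T. S \<subseteq> T \<Longrightarrow> g S \<Longrightarrow> g T"
    and "g (K \<union> {1..hi})" and "\<forall>i\<in>K. \<not> g (K - {i} \<union> {1..hi})"
    and "finite K" and "K \<inter> {1..hi} = {}" and "hi \<le> r" and "hi \<le> 2 ^ d"
  defines "T \<equiv> run_result f (minimize q b r K hi)"
  shows "K \<subseteq> T \<and> T \<subseteq> K \<union> {1..hi} \<and> g T \<and> (\<forall>i\<in>T. \<not> g (T - {i})) \<and>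
    set (run_queries f (minimize q b r K hi)) \<subseteq> range q \<and>
    length (run_queries f (minimize q b r K hi)) \<le> card (T - K) * (d + 1) + 1"
  unfolding T_def using assms(3-8)
proof (induction r arbitrary: K hi)
  case 0
  \<comment> \<open>Here \<open>hi\<close> is 0, so \<open>K\<close> itself is good and the fuel has
    not run out early.\<close>
  then show ?case by auto
next
  case (Suc r)
  show ?case
  proof (cases "g K")
    case True
    have "\<not> g (K - {i})" if "i \<in> K" for i
      using g_mono[of "K - {i}" "K - {i} \<union> {1..hi}"] Suc.prems(2) that by blast
    with True show ?thesis by (auto simp: g_def)
  next
    case False
    have "hi \<noteq> 0" using False Suc.prems(1) by (intro notI) simp
    \<comment> \<open>At index 0 the search sees \<open>K\<close>, just found not good; at
      \<open>hi\<close> it sees the set that is good by the invariant.\<close>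
    obtain j qs where j: "0 < j" "j \<le> hi" "g (K \<union> {1..j})" "\<not> g (K \<union> {1..j - 1})"
      and qs: "length qs \<le> d" "set qs \<subseteq> range (\<lambda>j. q (K \<union> {1..j}))"
      and run: "run_result f (bisect (\<lambda>j. q (K \<union> {1..j})) b 0 hi
            (\<lambda>j. minimize q b r (insert j K) (j - 1)))
          = run_result f (minimize q b r (insert j K) (j - 1))"
        "run_queries f (bisect (\<lambda>j. q (K \<union> {1..j})) b 0 hi
            (\<lambda>j. minimize q b r (insert j K) (j - 1)))
          = qs @ run_queries f (minimize q b r (insert j K) (j - 1))"
      using bisect_correct[of 0 hi f "\<lambda>j. q (K \<union> {1..j})" b d
          "\<lambda>j. minimize q b r (insert j K) (j - 1)"]
        \<open>hi \<noteq> 0\<close> False Suc.prems(1,6) by (auto simp: g_def)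
    define T' where "T' = run_result f (minimize q b r (insert j K) (j - 1))"
    have jK: "j \<notin> K" using Suc.prems(4) j by auto
    have "insert j K \<union> {1..j - 1} = K \<union> {1..j}" using j by auto
    then have 1: "g (insert j K \<union> {1..j - 1})" using j by simp
    \<comment> \<open>For \<open>j\<close> this is the switch found by the search. An older element
      stays indispensable because the set has only shrunk and \<open>g\<close> is upward
      closed.\<close>
    have 2: "\<not> g (insert j K - {i} \<union> {1..j - 1})" if "i \<in> insert j K" for i
    proof (cases "i = j")
      case True
      then have "insert j K - {i} \<union> {1..j - 1} = K \<union> {1..j - 1}" using jK by auto
      with j show ?thesis by simp
    next
      case False
      have "insert j K - {i} \<union> {1..j - 1} \<subseteq> K - {i} \<union> {1..hi}" using j by auto
      with g_mono Suc.prems(2) that False show ?thesis by blast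
    qed
    have "{1..j - 1} \<subseteq> {1..hi} - {j}" using j by auto
    then have 3: "insert j K \<inter> {1..j - 1} = {}" using Suc.prems(4) by blast
    have 4: "j - 1 \<le> r" "j - 1 \<le> 2 ^ d" using j Suc.prems(5,6) by auto
    have IH: "insert j K \<subseteq> T'" "T' \<subseteq> insert j K \<union> {1..j - 1}" "g T'" "\<forall>i\<in>T'. \<not> g (T' - {i})"
      "set (run_queries f (minimize q b r (insert j K) (j - 1))) \<subseteq> range q"
      "length (run_queries f (minimize q b r (insert j K) (j - 1)))
         \<le> card (T' - insert j K) * (d + 1) + 1"
      using Suc.IH[OF 1 ballI[OF 2] finite.insertI[OF Suc.prems(3)] 3 4, folded T'_def]
      by blast+
    have "finite T'" using IH(2) Suc.prems(3) by (auto intro: finite_subset)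
    moreover have "T' - K = insert j (T' - insert j K)" using IH(1) jK by auto
    ultimately have card: "card (T' - K) = Suc (card (T' - insert j K))"
      by (metis Diff_iff card_insert_disjoint finite_Diff insertI1)
    have ne: "f (q K) \<noteq> b" using False by (simp add: g_def)
    have res: "run_result f (minimize q b (Suc r) K hi) = T'"
      using ne run(1) by (simp add: T'_def)
    have queries: "run_queries f (minimize q b (Suc r) K hi)
        = q K # qs @ run_queries f (minimize q b r (insert j K) (j - 1))"
      using ne run(2) by simp
    have "T' \<subseteq> K \<union> {1..hi}" using IH(2) j by force
    moreover have "set (run_queries f (minimize q b (Suc r) K hi)) \<subseteq> range q"
      using qs(2) IH(5) unfolding queries by auto
    moreover have "length (run_queries f (minimize q b (Suc r) K hi)) \<le> card (T' - K) * (d + 1) + 1"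
      using qs(1) IH(6) unfolding queries card by simp
    ultimately show ?thesis using IH(1,3,4) unfolding res by blast
  qed
qed

section \<open>Certificates and hybrid points\<close>

lemma finite_cube: "finite (cube n)"
  by (simp add: cube_def finite_PiE)

lemma certificate_all:
  assumes "x \<in> cube n"
  shows "certificate n f x {1..n}"
  using assms by (auto simp: certificate_def cube_def PiE_restrict)

lemma cert_complexity_ge:
  assumes "z \<in> cube n" and "\<And>S. certificate n f z S \<Longrightarrow> m \<le> card S"
  shows "m \<le> cert_complexity n f"
proof -
  have "{S. certificate n f z S} \<subseteq> Pow {1..n}" by (auto simp: certificate_def)
  then have "finite {S. certificate n f z S}" by (rule finite_subset) simp
  then have "m \<le> cert_complexity_at n f z"
    \<comment> \<open>\<open>Min\<close> needs a nonempty set; the certificate \<open>{1..n}\<close>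
      provides a member.\<close>
    unfolding cert_complexity_at_def using assms certificate_all[OF assms(1), of f]
    by (subst Min_ge_iff) blast+
  also have "\<dots> \<le> cert_complexity n f"
    unfolding cert_complexity_def using assms(1) finite_cube by (intro Max_ge) auto
  finally show ?thesis .
qed

text \<open>For \<open>T\<close> inside \<open>{1..n}\<close>, this is the extreme point of the
  subcube agreeing with \<open>x\<close> on \<open>T\<close>: the least one if \<open>b\<close> is
  \<open>True\<close>, the greatest if \<open>b\<close> is \<open>False\<close>. One formula thus
  serves both values of \<open>f x\<close>.\<close>

definition hybrid :: "nat \<Rightarrow> (nat \<Rightarrow> bool) \<Rightarrow> bool \<Rightarrow> nat set \<Rightarrow> nat \<Rightarrow> bool" where
  "hybrid n x b T = (\<lambda>i\<in>{1..n}. if i \<in> T \<and> x i = b then b else \<not> b)"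

lemma hybrid_in_cube: "hybrid n x b T \<in> cube n"
  by (auto simp: hybrid_def cube_def)

lemma hybrid_all:
  assumes "x \<in> cube n"
  shows "hybrid n x b {1..n} = x"
proof
  show "hybrid n x b {1..n} i = x i" for i
    using assms PiE_arb[of x "{1..n}" _ i] by (auto simp: hybrid_def cube_def restrict_def)
qed

text \<open>"Above" means towards \<open>b\<close>: \<open>y\<close> has \<open>b\<close> wherever
  the hybrid does, so it lies above the hybrid for \<open>True\<close> and below it for
  \<open>False\<close>.\<close>

lemma value_above_hybrid:
  assumes "mono_on (cube n) f" and "f (hybrid n x b T) = b" and "y \<in> cube n"
    and "\<And>i. i \<in> {1..n} \<Longrightarrow> i \<in> T \<Longrightarrow> x i = b \<Longrightarrow> y i = b"
  shows "f y = b"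
proof (cases b)
  case True
  have "hybrid n x b T \<le> y"
    using assms(3,4) True by (auto simp: le_fun_def hybrid_def cube_def PiE_def extensional_def)
  with assms hybrid_in_cube True show ?thesis
    by (metis mono_onD le_boolD)
next
  case False
  have "y \<le> hybrid n x b T"
    using assms(3,4) False by (auto simp: le_fun_def hybrid_def cube_def PiE_def extensional_def)
  with assms hybrid_in_cube False show ?thesis
    by (metis mono_onD le_boolD)
qed

lemma certificate_hybrid:
  assumes "mono_on (cube n) f" and "f (hybrid n x (f x) T) = f x" and "T \<subseteq> {1..n}"
  shows "certificate n f x T"
  unfolding certificate_def
proof (intro conjI ballI impI)
  fix y assume "y \<in> cube n" and "restrict y T = restrict x T"
  then have "y i = x i" if "i \<in> T" for i using that by (metis restrict_apply')
  with assms(3) show "f y = f x"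
    using value_above_hybrid[OF assms(1,2) \<open>y \<in> cube n\<close>] by simp
qed (fact assms)

text \<open>The bound is read off at the hybrid point, not at \<open>x\<close>, where an
  inclusion-minimal certificate can be larger than a minimum one. The hybrids of \<open>T\<close>
  and \<open>T - {i}\<close> differ at most at \<open>i\<close>, so a certificate omitting
  \<open>i\<close> could not tell them apart.\<close>

lemma card_le_cert_complexity:
  assumes "f (hybrid n x b T) = b" and "\<And>i. i \<in> T \<Longrightarrow> f (hybrid n x b (T - {i})) \<noteq> b"
  shows "card T \<le> cert_complexity n f"
proof (rule cert_complexity_ge[OF hybrid_in_cube])
  fix S assume S: "certificate n f (hybrid n x b T) S"
  have "i \<in> S" if "i \<in> T" for i
  proof (rule ccontr)
    assume "i \<notin> S"
    then have "restrict (hybrid n x b (T - {i})) S = restrict (hybrid n x b T) S"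
      by (auto simp: hybrid_def restrict_def fun_eq_iff)
    with S have "f (hybrid n x b (T - {i})) = f (hybrid n x b T)"
      unfolding certificate_def using hybrid_in_cube by blast
    with assms that show False by simp
  qed
  moreover have "finite S" using S by (auto simp: certificate_def intro: finite_subset)
  ultimately show "card T \<le> card S" by (intro card_mono) auto
qed

text \<open>The summand 2 pays for querying \<open>x\<close> and for the last test. With L = log 2 n
  at least 1, the ceiling plus 1 is at most L + 2 \<le> 3 L; two more copies of
  \<open>query_bound\<close> \<ge> 1 absorb the 2. For n \<le> 1 the logarithm is 0 and at most 3
  queries are counted.\<close>

lemma query_count_bound:
  assumes "m \<le> n" and "m \<le> cert_complexity n f"
  shows "real (m * (nat \<lceil>log 2 (real n)\<rceil> + 1) + 2) \<le> 5 * query_bound n f"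
proof (cases "n \<ge> 2")
  case True
  then have log1: "log 2 (real n) \<ge> 1" by simp
  then have "real (nat \<lceil>log 2 (real n)\<rceil> + 1) \<le> 3 * log 2 (real n)" by linarith
  then have "real m * real (nat \<lceil>log 2 (real n)\<rceil> + 1)
      \<le> real (cert_complexity n f) * (3 * log 2 (real n))"
    using assms(2) by (intro mult_mono) auto
  then show ?thesis unfolding query_bound_def of_nat_add of_nat_mult by linarith
next
  case False
  then have "n = 0 \<or> n = 1" by auto
  moreover have "1 \<le> query_bound n f" by (simp add: query_bound_def)
  ultimately show ?thesis using assms(1) by (auto simp: log_def)
qed

theorem theorem1p1:
  "\<exists>(A :: nat \<Rightarrow> (nat \<Rightarrow> bool) \<Rightarrow> (nat \<Rightarrow> bool, bool, nat set) query_alg) (c :: real).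
     \<forall>(n :: nat) (f :: (nat \<Rightarrow> bool) \<Rightarrow> bool) (x :: nat \<Rightarrow> bool).
       mono_on (cube n) f \<longrightarrow> x \<in> cube n \<longrightarrow>
         set (run_queries f (A n x)) \<subseteq> cube n \<and>
         real (length (run_queries f (A n x))) \<le> c * query_bound n f \<and>
         certificate n f x (run_result f (A n x)) \<and>
         card (run_result f (A n x)) \<le> cert_complexity n f"
proof -
  define A :: "nat \<Rightarrow> (nat \<Rightarrow> bool) \<Rightarrow> (nat \<Rightarrow> bool, bool, nat set) query_alg"
    \<comment> \<open>The query at \<open>x\<close> reveals \<open>b\<close>, which fixes the
      direction of the hybrids.\<close>
    where "A = (\<lambda>n x. Query x (\<lambda>b. minimize (hybrid n x b) b n {} n))"
  have "set (run_queries f (A n x)) \<subseteq> cube n \<and>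
      real (length (run_queries f (A n x))) \<le> 5 * query_bound n f \<and>
      certificate n f x (run_result f (A n x)) \<and>
      card (run_result f (A n x)) \<le> cert_complexity n f"
    if f: "mono_on (cube n) f" and x: "x \<in> cube n" for n f x
  proof -
    define b where "b = f x"
    define M where "M = minimize (hybrid n x b) b n {} n"
    define T where "T = run_result f M"
    define d where "d = nat \<lceil>log 2 (real n)\<rceil>"
    have d: "n \<le> 2 ^ d"
    \<comment> \<open>Zero is separate since \<open>2 powr log 2 0\<close> is 1, not 0.\<close>
    proof (cases "n = 0")
      case False
      then have "real n = 2 powr (log 2 (real n))" by simp
      also have "\<dots> \<le> 2 powr real d" unfolding d_def by (intro powr_mono) linarith+
      finally have "real n \<le> real (2 ^ d)" by (simp add: powr_realpow)
      then show ?thesis by (simp only: of_nat_le_iff)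
    qed simp
    have start: "f (hybrid n x b ({} \<union> {1..n})) = b"
      using x by (simp only: hybrid_all b_def Un_empty_left)
    \<comment> \<open>The empty sets are written out so that the claim unifies with
      \<open>minimize_correct\<close> at \<open>K = {}\<close>.\<close>
    have "{} \<subseteq> T \<and> T \<subseteq> {} \<union> {1..n} \<and> f (hybrid n x b T) = b \<and>
        (\<forall>i\<in>T. f (hybrid n x b (T - {i})) \<noteq> b) \<and>
        set (run_queries f M) \<subseteq> range (hybrid n x b) \<and>
        length (run_queries f M) \<le> card (T - {}) * (d + 1) + 1"
      unfolding T_def M_def
    proof (rule minimize_correct)
      show "f (hybrid n x b S') = b" if "S \<subseteq> S'" "f (hybrid n x b S) = b" for S S'
        by (rule value_above_hybrid[OF f that(2) hybrid_in_cube])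
          (use that(1) in \<open>auto simp: hybrid_def\<close>)
    qed (use start d in simp_all)
    then have T: "T \<subseteq> {1..n}" "f (hybrid n x b T) = b"
        "\<And>i. i \<in> T \<Longrightarrow> f (hybrid n x b (T - {i})) \<noteq> b"
      and queries: "set (run_queries f M) \<subseteq> range (hybrid n x b)"
        "length (run_queries f M) \<le> card T * (d + 1) + 1"
      by simp_all
    have card: "card T \<le> cert_complexity n f" using T(2,3) by (rule card_le_cert_complexity)
    have cert: "certificate n f x T" using f T unfolding b_def by (intro certificate_hybrid)
    have A: "run_queries f (A n x) = x # run_queries f M" "run_result f (A n x) = T"
      by (simp_all add: A_def M_def T_def b_def)
    have "card T \<le> n" using T(1) card_mono[of "{1..n}" T] by simp
    then have "real (card T * (d + 1) + 2) \<le> 5 * query_bound n f"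
      using card unfolding d_def by (rule query_count_bound)
    moreover have "length (run_queries f (A n x)) \<le> card T * (d + 1) + 2"
      using queries(2) by (simp add: A)
    ultimately have "real (length (run_queries f (A n x))) \<le> 5 * query_bound n f"
      by (meson of_nat_le_iff order_trans)
    moreover have "set (run_queries f (A n x)) \<subseteq> cube n"
      using queries(1) x hybrid_in_cube by (auto simp: A)
    ultimately show ?thesis using card cert by (simp add: A)
  qed
  then show ?thesis by blast
qed

end
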